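(* Let $\mathcal{V}$ be any congruence-distributive variety. Then $\mathcal{V}$ has the congruence extension property if and only if $\mathcal{V}_{\mathrm{FSI}}$ has the congruence extension property.
   Context: A variety is a class of algebras of the same signature closed under homomorphic images, subalgebras, and direct products (equivalently, defined by equations). It is congruence-distributive if the congruence lattice $\mathrm{Con}\,\mathbf{A}$ is distributive for each member $\mathbf{A}$. An element $a$ of a lattice is meet-irreducible if $a=b\wedge c$ implies $a=b$ or $a=c$ (so a greatest element is meet-irreducible). $\mathcal{V}_{\mathrm{FSI}}$ is the class of finitely subdirectly irreducible members of $\mathcal{V}$, i.e., those $\mathbf{A}\in\mathcal{V}$ whose least congruence $\Delta_A=\{\langle a,a\rangle\mid a\in A\}$ is meet-irreducible in $\mathrm{Con}\,\mathbf{A}$ (trivial algebras included). An algebra $\mathbf{B}$ has the congruence extension property if for any subalgebra $\mathbf{A}$ of $\mathbf{B}$ and $\Theta\in\mathrm{Con}\,\mathbf{A}$ there exists a $\Phi\in\mathrm{Con}\,\mathbf{B}$ with $\Phi\cap A^2=\Theta$. A class of algebras has the congruence extension property if each of its members does. *)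

theory Defs
  imports "HOL-Algebra.Lattice"
begin

text \<open>
  A signature is a partial function from symbols to arities; symbols outside its domain do not
  belong to the signature, so the empty signature is covered. Operations are total on lists and
  only their values on tuples of carrier elements of the right length are significant. Algebras
  have nonempty carriers.
\<close>

type_synonym 'f signature = "'f \<Rightarrow> nat option"

record ('f, 'a) alg = "'a partial_object" +
  opn :: "'f \<Rightarrow> 'a list \<Rightarrow> 'a"

definition is_alg :: "'f signature \<Rightarrow> ('f, 'a) alg \<Rightarrow> bool" where
  "is_alg \<Sigma> A \<longleftrightarrow> carrier A \<noteq> {} \<and>
     (\<forall>f n xs. \<Sigma> f = Some n \<and> length xs = n \<and> set xs \<subseteq> carrier A \<longrightarrow> opn A f xs \<in> carrier A)"

definition subalg :: "'f signature \<Rightarrow> ('f, 'a) alg \<Rightarrow> ('f, 'a) alg \<Rightarrow> bool" where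
  "subalg \<Sigma> A B \<longleftrightarrow> is_alg \<Sigma> A \<and> is_alg \<Sigma> B \<and> carrier A \<subseteq> carrier B \<and>
     (\<forall>f n xs. \<Sigma> f = Some n \<and> length xs = n \<and> set xs \<subseteq> carrier A \<longrightarrow> opn A f xs = opn B f xs)"

definition alg_hom :: "'f signature \<Rightarrow> ('f, 'a) alg \<Rightarrow> ('f, 'b) alg \<Rightarrow> ('a \<Rightarrow> 'b) \<Rightarrow> bool" where
  "alg_hom \<Sigma> A B h \<longleftrightarrow> h \<in> carrier A \<rightarrow> carrier B \<and>
     (\<forall>f n xs. \<Sigma> f = Some n \<and> length xs = n \<and> set xs \<subseteq> carrier A \<longrightarrow>
        h (opn A f xs) = opn B f (map h xs))"

definition prod_alg :: "'i set \<Rightarrow> ('i \<Rightarrow> ('f, 'a) alg) \<Rightarrow> ('f, 'i \<Rightarrow> 'a) alg" where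
  "prod_alg I F = \<lparr>carrier = (\<Pi>\<^sub>E i\<in>I. carrier (F i)),
     opn = (\<lambda>f xs. \<lambda>i\<in>I. opn (F i) f (map (\<lambda>x. x i) xs))\<rparr>"

definition congruence :: "'f signature \<Rightarrow> ('f, 'a) alg \<Rightarrow> ('a \<times> 'a) set \<Rightarrow> bool" where
  "congruence \<Sigma> A \<Theta> \<longleftrightarrow> equiv (carrier A) \<Theta> \<and>
     (\<forall>f n xs ys. \<Sigma> f = Some n \<and> length xs = n \<and> length ys = n \<and>
        (\<forall>i<n. (xs ! i, ys ! i) \<in> \<Theta>) \<longrightarrow> (opn A f xs, opn A f ys) \<in> \<Theta>)"

definition Con :: "'f signature \<Rightarrow> ('f, 'a) alg \<Rightarrow> ('a \<times> 'a) set gorder" where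
  "Con \<Sigma> A = \<lparr>carrier = {\<Theta>. congruence \<Sigma> A \<Theta>}, eq = (=), le = (\<subseteq>)\<rparr>"

definition distributive :: "('a, 'b) gorder_scheme \<Rightarrow> bool" where
  "distributive L \<longleftrightarrow> lattice L \<and> (\<forall>x\<in>carrier L. \<forall>y\<in>carrier L. \<forall>z\<in>carrier L.
     x \<sqinter>\<^bsub>L\<^esub> (y \<squnion>\<^bsub>L\<^esub> z) = (x \<sqinter>\<^bsub>L\<^esub> y) \<squnion>\<^bsub>L\<^esub> (x \<sqinter>\<^bsub>L\<^esub> z))"

definition meet_irreducible :: "('a, 'b) gorder_scheme \<Rightarrow> 'a \<Rightarrow> bool" where
  "meet_irreducible L a \<longleftrightarrow> a \<in> carrier L \<and>
     (\<forall>b\<in>carrier L. \<forall>c\<in>carrier L. a = b \<sqinter>\<^bsub>L\<^esub> c \<longrightarrow> a = b \<or> a = c)"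

text \<open>
  Since there is no set of all algebras, a class of algebras is represented by its members whose
  carriers lie in a type \<open>'a\<close>, and closure is required for the algebras of that kind. This
  loses no generality: a variety in the usual sense yields such a set for every type \<open>'a\<close>,
  and any algebra has an isomorphic copy on a large enough type.

  A product of algebras over \<open>'a\<close> has carrier type \<open>'i \<Rightarrow> 'a\<close>, so closure under products is stated
  for all isomorphic copies of the product in \<open>'a\<close>. Index sets \<open>I :: 'a set\<close> suffice: up to
  isomorphism trivial factors can be dropped, and a product of nontrivial factors over \<open>I\<close> has
  at least \<open>2^|I|\<close> elements. The empty product puts the trivial algebras into every variety.
\<close>

definition variety :: "'f signature \<Rightarrow> ('f, 'a) alg set \<Rightarrow> bool" where
  "variety \<Sigma> V \<longleftrightarrow>
     (\<forall>A\<in>V. is_alg \<Sigma> A) \<and>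
     (\<forall>A\<in>V. \<forall>B h. is_alg \<Sigma> B \<and> alg_hom \<Sigma> A B h \<and> h ` carrier A = carrier B \<longrightarrow> B \<in> V) \<and>
     (\<forall>B\<in>V. \<forall>A. subalg \<Sigma> A B \<longrightarrow> A \<in> V) \<and>
     (\<forall>(I :: 'a set) F B h. (\<forall>i\<in>I. F i \<in> V) \<and> is_alg \<Sigma> B \<and> alg_hom \<Sigma> (prod_alg I F) B h \<and>
        bij_betw h (carrier (prod_alg I F)) (carrier B) \<longrightarrow> B \<in> V)"

definition congruence_distributive :: "'f signature \<Rightarrow> ('f, 'a) alg set \<Rightarrow> bool" where
  "congruence_distributive \<Sigma> V \<longleftrightarrow> (\<forall>A\<in>V. distributive (Con \<Sigma> A))"

definition FSI :: "'f signature \<Rightarrow> ('f, 'a) alg set \<Rightarrow> ('f, 'a) alg set" where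
  "FSI \<Sigma> V = {A \<in> V. meet_irreducible (Con \<Sigma> A) (Id_on (carrier A))}"

definition alg_cep :: "'f signature \<Rightarrow> ('f, 'a) alg \<Rightarrow> bool" where
  "alg_cep \<Sigma> B \<longleftrightarrow> (\<forall>A \<Theta>. subalg \<Sigma> A B \<and> \<Theta> \<in> carrier (Con \<Sigma> A) \<longrightarrow>
     (\<exists>\<Phi>\<in>carrier (Con \<Sigma> B). \<Phi> \<inter> (carrier A \<times> carrier A) = \<Theta>))"

definition class_cep :: "'f signature \<Rightarrow> ('f, 'a) alg set \<Rightarrow> bool" where
  "class_cep \<Sigma> K \<longleftrightarrow> (\<forall>B\<in>K. alg_cep \<Sigma> B)"

text \<open>
  The ordered set of congruences really is a lattice, so that the lattice operations (defined by
  choice from the order) take their intended values; in particular the conjunct \<open>lattice L\<close>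
  in \<open>distributive\<close> is no extra hypothesis.
\<close>

lemma congruence_Inter:
  assumes "S \<noteq> {}" and "\<And>\<Theta>. \<Theta> \<in> S \<Longrightarrow> congruence \<Sigma> A \<Theta>"
  shows "congruence \<Sigma> A (\<Inter>S)"
proof -
  have e: "equiv (carrier A) \<Theta>" if "\<Theta> \<in> S" for \<Theta>
    using assms(2)[OF that] by (simp add: congruence_def)
  have "equiv (carrier A) (\<Inter>S)"
  proof (rule equivI)
    show "\<Inter>S \<subseteq> carrier A \<times> carrier A"
      using assms(1) e unfolding equiv_def by blast
    show "refl_on (carrier A) (\<Inter>S)" "sym (\<Inter>S)"
      using e unfolding equiv_def refl_on_def sym_def by blast+
    show "trans (\<Inter>S)"
      using e unfolding equiv_def by (blast intro: trans_INTER[of S "\<lambda>x. x", simplified])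
  qed
  then show ?thesis
    using assms(2) unfolding congruence_def by blast
qed

lemma congruence_full:
  assumes "is_alg \<Sigma> A"
  shows "congruence \<Sigma> A (carrier A \<times> carrier A)"
proof -
  have "opn A f xs \<in> carrier A"
    if "\<Sigma> f = Some (length xs)" "\<forall>i<length xs. xs ! i \<in> carrier A" for f xs
    using assms that unfolding is_alg_def by (metis in_set_conv_nth subsetI)
  then show ?thesis
    unfolding congruence_def equiv_def refl_on_def sym_def trans_def by auto
qed

lemma greatest_Con_Int:
  assumes "congruence \<Sigma> A \<Theta>" "congruence \<Sigma> A \<Psi>"
  shows "greatest (Con \<Sigma> A) (\<Theta> \<inter> \<Psi>) (Lower (Con \<Sigma> A) {\<Theta>, \<Psi>})"
  using assms congruence_Inter[of "{\<Theta>, \<Psi>}" \<Sigma> A]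
  by (auto simp: greatest_def Lower_def Con_def)

lemma least_Con_Inter:
  assumes "is_alg \<Sigma> A" "congruence \<Sigma> A \<Theta>" "congruence \<Sigma> A \<Psi>"
  shows "least (Con \<Sigma> A) (\<Inter>{X. congruence \<Sigma> A X \<and> \<Theta> \<union> \<Psi> \<subseteq> X}) (Upper (Con \<Sigma> A) {\<Theta>, \<Psi>})"
proof -
  have "\<Theta> \<union> \<Psi> \<subseteq> carrier A \<times> carrier A"
    using assms(2,3) unfolding congruence_def equiv_def by blast
  then have "congruence \<Sigma> A (\<Inter>{X. congruence \<Sigma> A X \<and> \<Theta> \<union> \<Psi> \<subseteq> X})"
    using congruence_full[OF assms(1)] by (intro congruence_Inter) auto
  then show ?thesis
    using assms(2,3) by (auto simp: least_def Upper_def Con_def)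
qed

lemma lattice_Con:
  assumes "is_alg \<Sigma> A"
  shows "lattice (Con \<Sigma> A)"
proof -
  interpret partial_order "Con \<Sigma> A"
    by unfold_locales (auto simp: Con_def)
  show ?thesis
    by unfold_locales
      (use assms least_Con_Inter greatest_Con_Int in \<open>(fastforce simp: Con_def)+\<close>)
qed

lemma meet_Con:
  assumes "is_alg \<Sigma> A" "congruence \<Sigma> A \<Theta>" "congruence \<Sigma> A \<Psi>"
  shows "\<Theta> \<sqinter>\<^bsub>Con \<Sigma> A\<^esub> \<Psi> = \<Theta> \<inter> \<Psi>"
proof -
  interpret lattice "Con \<Sigma> A"
    using assms(1) by (rule lattice_Con)
  have "greatest (Con \<Sigma> A) (\<Theta> \<sqinter>\<^bsub>Con \<Sigma> A\<^esub> \<Psi>) (Lower (Con \<Sigma> A) {\<Theta>, \<Psi>})"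
    by (rule meetI) (use assms in \<open>auto simp: Con_def\<close>)
  then show ?thesis
    using greatest_Con_Int[OF assms(2,3)] by (rule greatest_unique)
qed

lemma join_Con:
  assumes "is_alg \<Sigma> A" "congruence \<Sigma> A \<Theta>" "congruence \<Sigma> A \<Psi>"
  shows "\<Theta> \<squnion>\<^bsub>Con \<Sigma> A\<^esub> \<Psi> = \<Inter>{X. congruence \<Sigma> A X \<and> \<Theta> \<union> \<Psi> \<subseteq> X}"
proof -
  interpret lattice "Con \<Sigma> A"
    using assms(1) by (rule lattice_Con)
  have "least (Con \<Sigma> A) (\<Theta> \<squnion>\<^bsub>Con \<Sigma> A\<^esub> \<Psi>) (Upper (Con \<Sigma> A) {\<Theta>, \<Psi>})"
    by (rule joinI) (use assms in \<open>auto simp: Con_def\<close>)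
  then show ?thesis
    using least_Con_Inter[OF assms] by (rule least_unique)
qed

end

theory Submission
  imports Defs
begin

text \<open>
  Only one direction has content. Let \<open>A\<close> be a subalgebra of \<open>B \<in> V\<close>. Every congruence of \<open>A\<close> is an
  intersection of meet-irreducible ones (\<open>meet_irreducible_separation\<close>), and intersections of
  extendable congruences are extendable, so it is enough to extend a meet-irreducible \<open>\<Theta>\<close>.
  Let \<open>\<Phi>\<close> be maximal among the congruences of \<open>B\<close> whose restriction to \<open>A\<close> lies below \<open>\<Theta>\<close>.
  In the distributive lattice of congruences of \<open>A\<close> the meet-irreducible \<open>\<Theta>\<close> is meet-prime
  (\<open>meet_irreducible_imp_prime\<close>). Hence if \<open>\<Phi> = X \<inter> Y\<close>, one of \<open>X\<close> and \<open>Y\<close> also restricts below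
  \<open>\<Theta>\<close> and so equals \<open>\<Phi>\<close>; that is, \<open>\<Phi>\<close> is meet-irreducible and \<open>B/\<Phi>\<close> is finitely subdirectly
  irreducible. Now \<open>\<Theta>\<close> induces a congruence on the image of \<open>A\<close> in \<open>B/\<Phi>\<close>; the congruence extension
  property of \<open>B/\<Phi>\<close> extends it, and the preimage in \<open>B\<close> of this extension restricts to \<open>\<Theta>\<close>
  (\<open>extend_along_hom\<close>).
\<close>

section \<open>Congruences and homomorphisms\<close>

lemma congruenceI:
  assumes "equiv (carrier A) \<Theta>"
    and "\<And>f xs ys. \<Sigma> f = Some (length xs) \<Longrightarrow> list_all2 (\<lambda>x y. (x, y) \<in> \<Theta>) xs ys \<Longrightarrow>
      (opn A f xs, opn A f ys) \<in> \<Theta>"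
  shows "congruence \<Sigma> A \<Theta>"
  using assms unfolding congruence_def by (simp add: list_all2_conv_all_nth)

lemma congruenceD_equiv: "congruence \<Sigma> A \<Theta> \<Longrightarrow> equiv (carrier A) \<Theta>"
  by (simp add: congruence_def)

lemma congruenceD_subset: "congruence \<Sigma> A \<Theta> \<Longrightarrow> \<Theta> \<subseteq> carrier A \<times> carrier A"
  by (simp add: congruence_def equiv_def)

lemma congruenceD_refl: "congruence \<Sigma> A \<Theta> \<Longrightarrow> x \<in> carrier A \<Longrightarrow> (x, x) \<in> \<Theta>"
  by (simp add: congruence_def equiv_def refl_on_def)

lemma congruenceD_sym: "congruence \<Sigma> A \<Theta> \<Longrightarrow> (x, y) \<in> \<Theta> \<Longrightarrow> (y, x) \<in> \<Theta>"
  by (auto simp: congruence_def equiv_def elim: symE)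

lemma congruenceD_trans: "congruence \<Sigma> A \<Theta> \<Longrightarrow> (x, y) \<in> \<Theta> \<Longrightarrow> (y, z) \<in> \<Theta> \<Longrightarrow> (x, z) \<in> \<Theta>"
  unfolding congruence_def equiv_def by (blast dest: transD)

lemma congruenceD_opn:
  "congruence \<Sigma> A \<Theta> \<Longrightarrow> \<Sigma> f = Some (length xs) \<Longrightarrow> list_all2 (\<lambda>x y. (x, y) \<in> \<Theta>) xs ys \<Longrightarrow>
    (opn A f xs, opn A f ys) \<in> \<Theta>"
  unfolding congruence_def by (metis list_all2_conv_all_nth)

lemma list_all2_congruence_carrier:
  assumes "\<Theta> \<subseteq> C \<times> C" "list_all2 (\<lambda>x y. (x, y) \<in> \<Theta>) xs ys"
  shows "set xs \<subseteq> C" "set ys \<subseteq> C"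
  using assms(2,1) by (induction rule: list_all2_induct) auto

lemma is_algD: "is_alg \<Sigma> A \<Longrightarrow> \<Sigma> f = Some (length xs) \<Longrightarrow> set xs \<subseteq> carrier A \<Longrightarrow> opn A f xs \<in> carrier A"
  by (simp add: is_alg_def)

lemma subalgD_opn:
  "subalg \<Sigma> A B \<Longrightarrow> \<Sigma> f = Some (length xs) \<Longrightarrow> set xs \<subseteq> carrier A \<Longrightarrow> opn A f xs = opn B f xs"
  by (simp add: subalg_def)

lemma alg_homD_opn:
  "alg_hom \<Sigma> A B h \<Longrightarrow> \<Sigma> f = Some (length xs) \<Longrightarrow> set xs \<subseteq> carrier A \<Longrightarrow>
    h (opn A f xs) = opn B f (map h xs)"
  by (simp add: alg_hom_def)

lemma congruence_Id_on:
  assumes "is_alg \<Sigma> A"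
  shows "congruence \<Sigma> A (Id_on (carrier A))"
proof (rule congruenceI)
  show "equiv (carrier A) (Id_on (carrier A))"
    by (auto simp: equiv_def refl_on_def sym_def trans_def)
next
  fix f xs ys
  assume f: "\<Sigma> f = Some (length xs)" and xy: "list_all2 (\<lambda>x y. (x, y) \<in> Id_on (carrier A)) xs ys"
  have "set xs \<subseteq> carrier A"
    using list_all2_congruence_carrier(1)[OF _ xy] by blast
  moreover have "xs = ys"
    using xy by (induction rule: list_all2_induct) auto
  ultimately show "(opn A f xs, opn A f ys) \<in> Id_on (carrier A)"
    using is_algD[OF assms f] by auto
qed

lemma congruence_restrict:
  assumes AB: "subalg \<Sigma> A B" and "congruence \<Sigma> B \<Phi>"
  shows "congruence \<Sigma> A (\<Phi> \<inter> carrier A \<times> carrier A)"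
proof (rule congruenceI)
  have "carrier A \<subseteq> carrier B"
    using AB by (simp add: subalg_def)
  then show "equiv (carrier A) (\<Phi> \<inter> carrier A \<times> carrier A)"
    by (intro equivI refl_onI symI transI)
      (auto intro: congruenceD_refl[OF assms(2)] congruenceD_sym[OF assms(2)] congruenceD_trans[OF assms(2)])
next
  fix f xs ys
  assume f: "\<Sigma> f = Some (length xs)"
    and xy: "list_all2 (\<lambda>x y. (x, y) \<in> \<Phi> \<inter> carrier A \<times> carrier A) xs ys"
  have s: "set xs \<subseteq> carrier A" "set ys \<subseteq> carrier A"
    using list_all2_congruence_carrier[OF _ xy] by blast+
  have f': "\<Sigma> f = Some (length ys)"
    using f list_all2_lengthD[OF xy] by simp
  have "list_all2 (\<lambda>x y. (x, y) \<in> \<Phi>) xs ys"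
    using xy by (rule list_all2_mono) auto
  then have "(opn B f xs, opn B f ys) \<in> \<Phi>"
    by (rule congruenceD_opn[OF assms(2) f])
  moreover have "is_alg \<Sigma> A"
    using AB by (simp add: subalg_def)
  ultimately show "(opn A f xs, opn A f ys) \<in> \<Phi> \<inter> carrier A \<times> carrier A"
    using subalgD_opn[OF AB f s(1)] subalgD_opn[OF AB f' s(2)]
      is_algD[of \<Sigma> A f xs] is_algD[of \<Sigma> A f ys] f f' s by simp
qed

lemma congruence_vimage:
  assumes "is_alg \<Sigma> A" and h: "alg_hom \<Sigma> A B h" and "congruence \<Sigma> B \<Psi>"
  shows "congruence \<Sigma> A {(x, y) \<in> carrier A \<times> carrier A. (h x, h y) \<in> \<Psi>}" (is "congruence _ _ ?P")
proof (rule congruenceI)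
  have "h x \<in> carrier B" if "x \<in> carrier A" for x
    using h that by (auto simp: alg_hom_def)
  then show "equiv (carrier A) ?P"
    by (intro equivI refl_onI symI transI)
      (auto intro: congruenceD_refl[OF assms(3)] congruenceD_sym[OF assms(3)] congruenceD_trans[OF assms(3)])
next
  fix f xs ys
  assume f: "\<Sigma> f = Some (length xs)" and xy: "list_all2 (\<lambda>x y. (x, y) \<in> ?P) xs ys"
  have s: "set xs \<subseteq> carrier A" "set ys \<subseteq> carrier A"
    using list_all2_congruence_carrier[OF _ xy] by blast+
  have f': "\<Sigma> f = Some (length ys)"
    using f list_all2_lengthD[OF xy] by simp
  have "list_all2 (\<lambda>x y. (x, y) \<in> \<Psi>) (map h xs) (map h ys)"
    unfolding list.rel_map using xy by (rule list_all2_mono) auto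
  then have "(opn B f (map h xs), opn B f (map h ys)) \<in> \<Psi>"
    using f by (intro congruenceD_opn[OF assms(3)]) auto
  then show "(opn A f xs, opn A f ys) \<in> ?P"
    using alg_homD_opn[OF h] is_algD[OF assms(1)] f f' s by simp
qed

lemma ex_map_lifts_list:
  assumes "set xs \<subseteq> h ` C"
  shows "\<exists>us. xs = map h us \<and> set us \<subseteq> C"
proof -
  have "xs = map h (map (inv_into C h) xs)"
    using assms by (auto simp: map_idI f_inv_into_f subset_iff)
  moreover have "set (map (inv_into C h) xs) \<subseteq> C"
    using assms by (auto intro: inv_into_into)
  ultimately show ?thesis
    by blast
qed

text \<open>
  Because \<open>\<Theta>\<close> contains the kernel of \<open>h\<close>, whether two elements are related by \<open>\<Theta>\<close> depends only on
  their images; this gives transitivity of the image of \<open>\<Theta>\<close> and its compatibility with the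
  operations.
\<close>
lemma congruence_image:
  assumes "is_alg \<Sigma> A" and h: "alg_hom \<Sigma> A B h" and surj: "h ` carrier A = carrier B"
    and \<Theta>: "congruence \<Sigma> A \<Theta>"
    and ker: "\<And>x y. x \<in> carrier A \<Longrightarrow> y \<in> carrier A \<Longrightarrow> h x = h y \<Longrightarrow> (x, y) \<in> \<Theta>"
  shows "congruence \<Sigma> B (map_prod h h ` \<Theta>)"
    and "\<And>x y. x \<in> carrier A \<Longrightarrow> y \<in> carrier A \<Longrightarrow> (h x, h y) \<in> map_prod h h ` \<Theta> \<longleftrightarrow> (x, y) \<in> \<Theta>"
proof -
  note sub = congruenceD_subset[OF \<Theta>]
  note sy = congruenceD_sym[OF \<Theta>] and tr = congruenceD_trans[OF \<Theta>]
  show iff: "(h x, h y) \<in> map_prod h h ` \<Theta> \<longleftrightarrow> (x, y) \<in> \<Theta>"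
    if "x \<in> carrier A" "y \<in> carrier A" for x y
  proof
    assume "(h x, h y) \<in> map_prod h h ` \<Theta>"
    then obtain x' y' where xy': "(x', y') \<in> \<Theta>" "h x = h x'" "h y = h y'"
      by auto
    then have "(x, x') \<in> \<Theta>" "(y', y) \<in> \<Theta>"
      using ker[of x x'] ker[of y' y] that sub by auto
    then show "(x, y) \<in> \<Theta>"
      using xy'(1) tr by blast
  qed force
  show "congruence \<Sigma> B (map_prod h h ` \<Theta>)"
  proof (rule congruenceI)
    show "equiv (carrier B) (map_prod h h ` \<Theta>)"
    proof (rule equivI)
      show "map_prod h h ` \<Theta> \<subseteq> carrier B \<times> carrier B"
        using sub surj by auto
      show "refl_on (carrier B) (map_prod h h ` \<Theta>)"
        unfolding refl_on_def surj[symmetric] using iff ker by simp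
      show "sym (map_prod h h ` \<Theta>)"
        unfolding sym_def using sy by force
      show "trans (map_prod h h ` \<Theta>)"
      proof (rule transI)
        fix a b c assume ab: "(a, b) \<in> map_prod h h ` \<Theta>" and bc: "(b, c) \<in> map_prod h h ` \<Theta>"
        obtain x y where xy: "(x, y) \<in> \<Theta>" "a = h x" "b = h y"
          using ab by auto
        obtain z where z: "z \<in> carrier A" "c = h z"
          using bc sub by auto
        have "(y, z) \<in> \<Theta>"
          using iff[of y z] bc xy z sub by auto
        then have "(x, z) \<in> \<Theta>"
          using tr xy(1) by blast
        then show "(a, c) \<in> map_prod h h ` \<Theta>"
          using xy(2) z(2) by force
      qed
    qed
  next
    fix f xs ys
    assume f: "\<Sigma> f = Some (length xs)" and xy: "list_all2 (\<lambda>x y. (x, y) \<in> map_prod h h ` \<Theta>) xs ys"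
    have "map_prod h h ` \<Theta> \<subseteq> carrier B \<times> carrier B"
      using sub surj by auto
    from list_all2_congruence_carrier[OF this xy]
    obtain us vs where us: "xs = map h us" "set us \<subseteq> carrier A"
      and vs: "ys = map h vs" "set vs \<subseteq> carrier A"
      unfolding surj[symmetric] by (metis ex_map_lifts_list)
    have "list_all2 (\<lambda>u v. (u, v) \<in> \<Theta>) us vs"
      using xy us vs iff by (auto simp: list_all2_conv_all_nth subset_iff)
    then have "(opn A f us, opn A f vs) \<in> \<Theta>" and "length vs = length us"
      using congruenceD_opn[OF \<Theta>, of f us vs] f us(1) list_all2_lengthD[of _ us vs] by simp_all
    moreover have "h (opn A f us) = opn B f xs" "h (opn A f vs) = opn B f ys"
      using alg_homD_opn[OF h] f us vs \<open>length vs = length us\<close> by auto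
    ultimately show "(opn B f xs, opn B f ys) \<in> map_prod h h ` \<Theta>"
      by force
  qed
qed

section \<open>Quotients and images of subalgebras\<close>

text \<open>
  The classes of a congruence are represented by chosen elements, so that the quotient is again an
  algebra on the type of the given one and can belong to the same class of algebras.
\<close>
definition class_rep :: "('a \<times> 'a) set \<Rightarrow> 'a \<Rightarrow> 'a" where
  "class_rep \<Phi> x = (SOME y. y \<in> \<Phi> `` {x})"

definition quotient_alg :: "('f, 'a) alg \<Rightarrow> ('a \<times> 'a) set \<Rightarrow> ('f, 'a) alg" where
  "quotient_alg B \<Phi> = \<lparr>carrier = class_rep \<Phi> ` carrier B, opn = (\<lambda>f xs. class_rep \<Phi> (opn B f xs))\<rparr>"

lemma class_rep_related:
  assumes "equiv C \<Phi>" "x \<in> C"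
  shows "(x, class_rep \<Phi> x) \<in> \<Phi>"
  unfolding class_rep_def using someI_ex[of "\<lambda>y. y \<in> \<Phi> `` {x}"] equiv_class_self[OF assms] by blast

lemma class_rep_eq_iff:
  assumes "equiv C \<Phi>" "x \<in> C" "y \<in> C"
  shows "class_rep \<Phi> x = class_rep \<Phi> y \<longleftrightarrow> (x, y) \<in> \<Phi>"
proof
  assume "class_rep \<Phi> x = class_rep \<Phi> y"
  then show "(x, y) \<in> \<Phi>"
    using class_rep_related[OF assms(1)] assms unfolding equiv_def sym_def trans_def by metis
next
  assume "(x, y) \<in> \<Phi>"
  then show "class_rep \<Phi> x = class_rep \<Phi> y"
    using equiv_class_eq[OF assms(1)] by (simp add: class_rep_def)
qed

lemma
  assumes B: "is_alg \<Sigma> B" and \<Phi>: "congruence \<Sigma> B \<Phi>"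
  shows is_alg_quotient: "is_alg \<Sigma> (quotient_alg B \<Phi>)"
    and alg_hom_class_rep: "alg_hom \<Sigma> B (quotient_alg B \<Phi>) (class_rep \<Phi>)"
proof -
  note eq = congruenceD_equiv[OF \<Phi>]
  have mem: "class_rep \<Phi> x \<in> carrier B" if "x \<in> carrier B" for x
    using class_rep_related[OF eq that] congruenceD_subset[OF \<Phi>] by auto
  show "is_alg \<Sigma> (quotient_alg B \<Phi>)"
    unfolding is_alg_def
  proof (intro conjI allI impI)
    show "carrier (quotient_alg B \<Phi>) \<noteq> {}"
      using B by (simp add: is_alg_def quotient_alg_def)
  next
    fix f n xs
    assume "\<Sigma> f = Some n \<and> length xs = n \<and> set xs \<subseteq> carrier (quotient_alg B \<Phi>)"
    then have "\<Sigma> f = Some (length xs)" "set xs \<subseteq> carrier B"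
      using mem by (auto simp: quotient_alg_def)
    then show "opn (quotient_alg B \<Phi>) f xs \<in> carrier (quotient_alg B \<Phi>)"
      using is_algD[OF B] by (simp add: quotient_alg_def)
  qed
  show "alg_hom \<Sigma> B (quotient_alg B \<Phi>) (class_rep \<Phi>)"
    unfolding alg_hom_def
  proof (intro conjI allI impI)
    fix f n xs
    assume "\<Sigma> f = Some n \<and> length xs = n \<and> set xs \<subseteq> carrier B"
    then have f: "\<Sigma> f = Some (length xs)" and xs: "set xs \<subseteq> carrier B"
      by auto
    have "list_all2 (\<lambda>x y. (x, y) \<in> \<Phi>) xs (map (class_rep \<Phi>) xs)"
      using xs class_rep_related[OF eq] by (auto simp: list_all2_conv_all_nth subset_iff)
    then have "(opn B f xs, opn B f (map (class_rep \<Phi>) xs)) \<in> \<Phi>"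
      by (rule congruenceD_opn[OF \<Phi> f])
    then show "class_rep \<Phi> (opn B f xs) = opn (quotient_alg B \<Phi>) f (map (class_rep \<Phi>) xs)"
      using equiv_class_eq[OF eq] by (simp add: quotient_alg_def class_rep_def)
  qed (simp add: quotient_alg_def)
qed

lemma hom_image_subalg:
  fixes A :: "('f, 'a) alg" and B :: "('f, 'a) alg" and C :: "('f, 'b) alg"
  assumes AB: "subalg \<Sigma> A B" and C: "is_alg \<Sigma> C" and h: "alg_hom \<Sigma> B C h"
  defines "D \<equiv> \<lparr>carrier = h ` carrier A, opn = opn C\<rparr>"
  shows "subalg \<Sigma> D C" and "alg_hom \<Sigma> A D h"
proof -
  have A: "is_alg \<Sigma> A" and sub: "carrier A \<subseteq> carrier B"
    using AB by (auto simp: subalg_def)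
  have op: "h (opn A f us) = opn C f (map h us)"
    if "\<Sigma> f = Some (length us)" "set us \<subseteq> carrier A" for f us
    using subalgD_opn[OF AB that] alg_homD_opn[OF h that(1)] that(2) sub by force
  then show "alg_hom \<Sigma> A D h"
    unfolding alg_hom_def D_def by simp
  have "opn C f xs \<in> h ` carrier A"
    if f: "\<Sigma> f = Some (length xs)" and xs: "set xs \<subseteq> h ` carrier A" for f xs
  proof -
    obtain us where us: "xs = map h us" "set us \<subseteq> carrier A"
      using ex_map_lifts_list[OF xs] by blast
    then have "opn C f xs = h (opn A f us)" "opn A f us \<in> carrier A"
      using op[of f us] is_algD[OF A, of f us] f by auto
    then show ?thesis
      by simp
  qed
  moreover have "h ` carrier A \<subseteq> carrier C"
    using h sub by (auto simp: alg_hom_def)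
  ultimately show "subalg \<Sigma> D C"
    using A C by (auto simp: subalg_def is_alg_def D_def)
qed

text \<open>
  The congruence \<open>\<Theta>\<close> is pushed forward to the image of \<open>A\<close>, extended there, and the extension is
  pulled back to \<open>B\<close>. Since \<open>\<Theta>\<close> contains the kernel of \<open>h\<close> on \<open>A\<close>, the round trip adds no pairs on \<open>A\<close>.
\<close>
lemma extend_along_hom:
  assumes AB: "subalg \<Sigma> A B" and \<Theta>: "congruence \<Sigma> A \<Theta>"
    and C: "is_alg \<Sigma> C" "alg_cep \<Sigma> C" and h: "alg_hom \<Sigma> B C h"
    and ker: "\<And>x y. x \<in> carrier A \<Longrightarrow> y \<in> carrier A \<Longrightarrow> h x = h y \<Longrightarrow> (x, y) \<in> \<Theta>"
  shows "\<exists>\<Phi>. congruence \<Sigma> B \<Phi> \<and> \<Phi> \<inter> (carrier A \<times> carrier A) = \<Theta>"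
proof -
  define D where "D = \<lparr>carrier = h ` carrier A, opn = opn C\<rparr>"
  have DC: "subalg \<Sigma> D C" and hD: "alg_hom \<Sigma> A D h"
    unfolding D_def by (rule hom_image_subalg[OF AB C(1) h])+
  have A: "is_alg \<Sigma> A" and B: "is_alg \<Sigma> B" and sub: "carrier A \<subseteq> carrier B"
    using AB by (auto simp: subalg_def)
  have surj: "h ` carrier A = carrier D"
    by (simp add: D_def)
  have im_cong: "congruence \<Sigma> D (map_prod h h ` \<Theta>)"
    using A hD surj \<Theta> ker by (rule congruence_image(1))
  have im_iff: "(h x, h y) \<in> map_prod h h ` \<Theta> \<longleftrightarrow> (x, y) \<in> \<Theta>"
    if "x \<in> carrier A" "y \<in> carrier A" for x y
    using A hD surj \<Theta> ker that by (rule congruence_image(2))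
  obtain \<Psi> where \<Psi>: "congruence \<Sigma> C \<Psi>" "\<Psi> \<inter> (carrier D \<times> carrier D) = map_prod h h ` \<Theta>"
    using C(2)[unfolded alg_cep_def, rule_format, of D "map_prod h h ` \<Theta>"] DC im_cong
    by (auto simp: Con_def)
  let ?\<Phi> = "{(x, y) \<in> carrier B \<times> carrier B. (h x, h y) \<in> \<Psi>}"
  have "(x, y) \<in> ?\<Phi> \<longleftrightarrow> (x, y) \<in> \<Theta>" if xy: "x \<in> carrier A" "y \<in> carrier A" for x y
  proof -
    have "(x, y) \<in> ?\<Phi> \<longleftrightarrow> (h x, h y) \<in> map_prod h h ` \<Theta>"
      unfolding \<Psi>(2)[symmetric] using xy sub by (auto simp: D_def)
    then show ?thesis
      using im_iff[OF xy] by simp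
  qed
  then have "?\<Phi> \<inter> (carrier A \<times> carrier A) = \<Theta>"
    using congruenceD_subset[OF \<Theta>] by auto
  then show ?thesis
    using congruence_vimage[OF B h \<Psi>(1)] by blast
qed

section \<open>Meet-irreducible congruences\<close>

lemma meet_irreducible_Con_iff:
  assumes "is_alg \<Sigma> A"
  shows "meet_irreducible (Con \<Sigma> A) \<Theta> \<longleftrightarrow> congruence \<Sigma> A \<Theta> \<and>
    (\<forall>X Y. congruence \<Sigma> A X \<longrightarrow> congruence \<Sigma> A Y \<longrightarrow> \<Theta> = X \<inter> Y \<longrightarrow> \<Theta> = X \<or> \<Theta> = Y)"
proof -
  have "carrier (Con \<Sigma> A) = {\<Theta>. congruence \<Sigma> A \<Theta>}"
    by (simp add: Con_def)
  then show ?thesis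
    using meet_Con[OF assms] unfolding meet_irreducible_def by auto
qed

text \<open>
  If \<open>X \<inter> Y \<subseteq> \<Theta>\<close>, distributivity gives \<open>\<Theta> = \<Theta> \<squnion> (X \<sqinter> Y) = (\<Theta> \<squnion> X) \<sqinter> (\<Theta> \<squnion> Y)\<close>, so \<open>\<Theta>\<close> equals one
  of the two joins. The second equality is the dual of the distributive law in the definition of
  \<open>distributive\<close>, hence the computation in two steps.
\<close>
lemma meet_irreducible_imp_prime:
  assumes A: "is_alg \<Sigma> A" and dist: "distributive (Con \<Sigma> A)"
    and irr: "meet_irreducible (Con \<Sigma> A) \<Theta>"
    and X: "congruence \<Sigma> A X" and Y: "congruence \<Sigma> A Y" and XY: "X \<inter> Y \<subseteq> \<Theta>"
  shows "X \<subseteq> \<Theta> \<or> Y \<subseteq> \<Theta>"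
proof -
  define J where "J P Q = \<Inter>{Z. congruence \<Sigma> A Z \<and> P \<union> Q \<subseteq> Z}" for P Q
  have \<Theta>: "congruence \<Sigma> A \<Theta>"
    using irr by (simp add: meet_irreducible_Con_iff[OF A])
  have congJ: "congruence \<Sigma> A (J P Q)" if "congruence \<Sigma> A P" "congruence \<Sigma> A Q" for P Q
    using least_Con_Inter[OF A that] unfolding least_def J_def Con_def by auto
  have upper: "P \<subseteq> J P Q" "Q \<subseteq> J P Q" for P Q
    unfolding J_def by auto
  have least: "J P Q \<subseteq> Z" if "P \<subseteq> Z" "Q \<subseteq> Z" "congruence \<Sigma> A Z" for P Q Z
    unfolding J_def using that by auto
  have int: "congruence \<Sigma> A (P \<inter> Q)" if "congruence \<Sigma> A P" "congruence \<Sigma> A Q" for P Q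
    using congruence_Inter[of "{P, Q}" \<Sigma> A] that by auto
  have d: "P \<inter> J Q R = J (P \<inter> Q) (P \<inter> R)"
    if "congruence \<Sigma> A P" "congruence \<Sigma> A Q" "congruence \<Sigma> A R" for P Q R
  proof -
    have "P \<sqinter>\<^bsub>Con \<Sigma> A\<^esub> (Q \<squnion>\<^bsub>Con \<Sigma> A\<^esub> R) = (P \<sqinter>\<^bsub>Con \<Sigma> A\<^esub> Q) \<squnion>\<^bsub>Con \<Sigma> A\<^esub> (P \<sqinter>\<^bsub>Con \<Sigma> A\<^esub> R)"
      using dist that unfolding distributive_def by (simp add: Con_def)
    then show ?thesis
      using that by (simp only: join_Con[OF A, folded J_def] meet_Con[OF A] int congJ)
  qed
  have "J \<Theta> X \<inter> J \<Theta> Y = J (J \<Theta> X \<inter> \<Theta>) (J \<Theta> X \<inter> Y)"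
    by (rule d) (use \<Theta> X Y congJ in auto)
  also have "J \<Theta> X \<inter> Y = J (Y \<inter> \<Theta>) (Y \<inter> X)"
    using d[OF Y \<Theta> X] by (simp add: Int_commute)
  also have "J (J \<Theta> X \<inter> \<Theta>) (J (Y \<inter> \<Theta>) (Y \<inter> X)) \<subseteq> \<Theta>"
    using XY \<Theta> by (intro least) auto
  finally have "\<Theta> = J \<Theta> X \<inter> J \<Theta> Y"
    using upper by blast
  then have "\<Theta> = J \<Theta> X \<or> \<Theta> = J \<Theta> Y"
    using irr congJ[OF \<Theta> X] congJ[OF \<Theta> Y] unfolding meet_irreducible_Con_iff[OF A] by blast
  then show ?thesis
    using upper by metis
qed

text \<open>Operations are finitary, so each instance of compatibility takes place in one member of the chain.\<close>
lemma congruence_chain_Union: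
  assumes ne: "C \<noteq> {}" and ch: "\<And>X Y. X \<in> C \<Longrightarrow> Y \<in> C \<Longrightarrow> X \<subseteq> Y \<or> Y \<subseteq> X"
    and cong: "\<And>X. X \<in> C \<Longrightarrow> congruence \<Sigma> A X"
  shows "congruence \<Sigma> A (\<Union>C)"
proof (rule congruenceI)
  show "equiv (carrier A) (\<Union>C)"
  proof (rule equivI)
    show "\<Union>C \<subseteq> carrier A \<times> carrier A"
      using cong congruenceD_subset by blast
    show "refl_on (carrier A) (\<Union>C)"
      using ne congruenceD_refl[OF cong] by (auto intro!: refl_onI)
    show "sym (\<Union>C)"
      using congruenceD_sym[OF cong] by (auto intro!: symI)
    show "trans (\<Union>C)"
    proof (rule transI)
      fix x y z assume "(x, y) \<in> \<Union>C" "(y, z) \<in> \<Union>C"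
      then obtain X where "X \<in> C" "(x, y) \<in> X" "(y, z) \<in> X"
        using ch by blast
      then show "(x, z) \<in> \<Union>C"
        using congruenceD_trans[OF cong] by blast
    qed
  qed
next
  fix f xs ys
  assume f: "\<Sigma> f = Some (length xs)" and xy: "list_all2 (\<lambda>x y. (x, y) \<in> \<Union>C) xs ys"
  from xy have "\<exists>X\<in>C. list_all2 (\<lambda>x y. (x, y) \<in> X) xs ys"
  proof (induction rule: list_all2_induct)
    case Nil
    then show ?case
      using ne by auto
  next
    case (Cons x xs y ys)
    then obtain X Y where XY: "X \<in> C" "(x, y) \<in> X" "Y \<in> C" "list_all2 (\<lambda>x y. (x, y) \<in> Y) xs ys"
      by auto
    from ch[OF XY(1,3)] show ?case
    proof
      assume "X \<subseteq> Y"
      then show ?thesis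
        using XY by (intro bexI[of _ Y]) auto
    next
      assume "Y \<subseteq> X"
      then have "list_all2 (\<lambda>x y. (x, y) \<in> X) xs ys"
        by (intro list_all2_mono[OF XY(4)]) auto
      then show ?thesis
        using XY by (intro bexI[of _ X]) auto
    qed
  qed
  then show "(opn A f xs, opn A f ys) \<in> \<Union>C"
    using congruenceD_opn[OF cong f] by blast
qed

text \<open>
  Zorn's lemma is needed twice: with \<open>D\<close> a single pair, and with \<open>D\<close> the pairs of a subalgebra that
  lie outside a given congruence.
\<close>
lemma ex_maximal_congruence_avoiding:
  assumes "congruence \<Sigma> A \<Theta>" "\<Theta> \<inter> D = {}"
  shows "\<exists>M. congruence \<Sigma> A M \<and> \<Theta> \<subseteq> M \<and> M \<inter> D = {} \<and>
    (\<forall>X. congruence \<Sigma> A X \<longrightarrow> M \<subseteq> X \<longrightarrow> X \<inter> D = {} \<longrightarrow> X = M)"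
proof -
  let ?S = "{X. congruence \<Sigma> A X \<and> \<Theta> \<subseteq> X \<and> X \<inter> D = {}}"
  have "\<exists>M\<in>?S. \<forall>X\<in>?S. M \<subseteq> X \<longrightarrow> X = M"
  proof (rule subset_Zorn_nonempty)
    show "?S \<noteq> {}"
      using assms by auto
  next
    fix C assume C: "C \<noteq> {}" "subset.chain ?S C"
    have "X \<subseteq> Y \<or> Y \<subseteq> X" if "X \<in> C" "Y \<in> C" for X Y
      using C(2) that unfolding subset.chain_def by blast
    moreover have "congruence \<Sigma> A X" if "X \<in> C" for X
      using C(2) that unfolding subset.chain_def by blast
    ultimately have "congruence \<Sigma> A (\<Union>C)"
      by (rule congruence_chain_Union[OF C(1)])
    then show "\<Union>C \<in> ?S"
      using C by (auto simp: subset.chain_def)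
  qed
  then obtain M where M: "M \<in> ?S" "\<forall>X\<in>?S. M \<subseteq> X \<longrightarrow> X = M"
    by (rule bexE)
  have "X = M" if "congruence \<Sigma> A X" "M \<subseteq> X" "X \<inter> D = {}" for X
    using M(1) that by (intro M(2)[rule_format]) auto
  then show ?thesis
    using M(1) by (intro exI[of _ M]) simp
qed

text \<open>
  A congruence maximal among those that omit \<open>(a, b)\<close> is meet-irreducible, because every strictly
  larger congruence contains \<open>(a, b)\<close>.
\<close>
lemma meet_irreducible_separation:
  assumes A: "is_alg \<Sigma> A" and "congruence \<Sigma> A \<Theta>" "(a, b) \<notin> \<Theta>"
  shows "\<exists>M. meet_irreducible (Con \<Sigma> A) M \<and> \<Theta> \<subseteq> M \<and> (a, b) \<notin> M"
proof -
  obtain M where M: "congruence \<Sigma> A M" "\<Theta> \<subseteq> M" "(a, b) \<notin> M"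
    and max: "\<And>X. congruence \<Sigma> A X \<Longrightarrow> M \<subseteq> X \<Longrightarrow> (a, b) \<notin> X \<Longrightarrow> X = M"
    using ex_maximal_congruence_avoiding[OF assms(2), of "{(a, b)}"] assms(3) by auto
  have "M = X \<or> M = Y" if "congruence \<Sigma> A X" "congruence \<Sigma> A Y" "M = X \<inter> Y" for X Y
    using max[OF that(1)] max[OF that(2)] that(3) M(3) by blast
  then have "meet_irreducible (Con \<Sigma> A) M"
    using M(1) by (simp add: meet_irreducible_Con_iff[OF A])
  then show ?thesis
    using M by blast
qed

text \<open>
  Taking preimages under the projection \<open>B \<rightarrow> B/\<Phi>\<close> is injective on congruences, preserves
  intersections and sends the least congruence to \<open>\<Phi>\<close>, so a decomposition of the former gives a
  decomposition of \<open>\<Phi>\<close>.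
\<close>
lemma meet_irreducible_quotient:
  assumes B: "is_alg \<Sigma> B" and irr: "meet_irreducible (Con \<Sigma> B) \<Phi>"
  shows "meet_irreducible (Con \<Sigma> (quotient_alg B \<Phi>)) (Id_on (carrier (quotient_alg B \<Phi>)))"
proof -
  let ?Q = "quotient_alg B \<Phi>" and ?r = "class_rep \<Phi>"
  have \<Phi>: "congruence \<Sigma> B \<Phi>"
    using irr by (simp add: meet_irreducible_Con_iff[OF B])
  note Q = is_alg_quotient[OF B \<Phi>] and r = alg_hom_class_rep[OF B \<Phi>]
  note r_eq = class_rep_eq_iff[OF congruenceD_equiv[OF \<Phi>]]
  have cQ: "carrier ?Q = ?r ` carrier B"
    by (simp add: quotient_alg_def)
  define pb where "pb Z = {(x, y) \<in> carrier B \<times> carrier B. (?r x, ?r y) \<in> Z}" for Z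
  have pb_cong: "congruence \<Sigma> B (pb Z)" if "congruence \<Sigma> ?Q Z" for Z
    unfolding pb_def by (rule congruence_vimage[OF B r that])
  have pb_Id: "pb (Id_on (carrier ?Q)) = \<Phi>"
  proof -
    have "(x, y) \<in> pb (Id_on (carrier ?Q)) \<longleftrightarrow> (x, y) \<in> \<Phi>" if "x \<in> carrier B" "y \<in> carrier B" for x y
      using that r_eq[OF that] by (simp add: pb_def Id_on_iff cQ)
    moreover have "pb (Id_on (carrier ?Q)) \<subseteq> carrier B \<times> carrier B"
      by (auto simp: pb_def)
    ultimately show ?thesis
      using congruenceD_subset[OF \<Phi>] by blast
  qed
  have pb_inj: "Z = W" if "pb Z = pb W" "congruence \<Sigma> ?Q Z" "congruence \<Sigma> ?Q W" for Z W
  proof -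
    have "Z \<subseteq> ?r ` carrier B \<times> ?r ` carrier B" "W \<subseteq> ?r ` carrier B \<times> ?r ` carrier B"
      using that(2,3)[THEN congruenceD_subset] by (simp_all add: cQ)
    moreover have "(?r x, ?r y) \<in> Z \<longleftrightarrow> (?r x, ?r y) \<in> W" if "x \<in> carrier B" "y \<in> carrier B" for x y
      using that \<open>pb Z = pb W\<close> by (auto simp: pb_def set_eq_iff)
    ultimately show ?thesis
      by blast
  qed
  note id = congruence_Id_on[OF Q]
  have "Id_on (carrier ?Q) = X \<or> Id_on (carrier ?Q) = Y"
    if X: "congruence \<Sigma> ?Q X" and Y: "congruence \<Sigma> ?Q Y" and eq: "Id_on (carrier ?Q) = X \<inter> Y" for X Y
  proof -
    have "pb (X \<inter> Y) = pb X \<inter> pb Y"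
      by (auto simp: pb_def)
    then have "\<Phi> = pb X \<inter> pb Y"
      using pb_Id eq by simp
    then have "\<Phi> = pb X \<or> \<Phi> = pb Y"
      using irr pb_cong[OF X] pb_cong[OF Y] unfolding meet_irreducible_Con_iff[OF B] by blast
    then show ?thesis
      using pb_inj[OF _ id X] pb_inj[OF _ id Y] pb_Id by blast
  qed
  then show ?thesis
    using id by (simp add: meet_irreducible_Con_iff[OF Q])
qed

section \<open>Extending congruences\<close>

text \<open>
  The congruence of \<open>B\<close> generated by a congruence \<open>\<Theta>\<close> of \<open>A\<close> extends it: if \<open>a\<close> and \<open>b\<close> in \<open>A\<close> are not
  related by \<open>\<Theta>\<close>, some meet-irreducible \<open>M \<supseteq> \<Theta>\<close> omits \<open>(a, b)\<close>, and an extension of \<open>M\<close> to \<open>B\<close>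
  lies above the generated congruence and still omits \<open>(a, b)\<close>.
\<close>
lemma alg_cep_if_meet_irreducibles_extend:
  assumes B: "is_alg \<Sigma> B"
    and ext: "\<And>A M. subalg \<Sigma> A B \<Longrightarrow> meet_irreducible (Con \<Sigma> A) M \<Longrightarrow>
      \<exists>\<Phi>. congruence \<Sigma> B \<Phi> \<and> \<Phi> \<inter> (carrier A \<times> carrier A) = M"
  shows "alg_cep \<Sigma> B"
  unfolding alg_cep_def
proof (intro allI impI)
  fix A \<Theta>
  assume "subalg \<Sigma> A B \<and> \<Theta> \<in> carrier (Con \<Sigma> A)"
  then have AB: "subalg \<Sigma> A B" and \<Theta>: "congruence \<Sigma> A \<Theta>"
    by (auto simp: Con_def)
  have A: "is_alg \<Sigma> A" and sub: "carrier A \<subseteq> carrier B"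
    using AB by (auto simp: subalg_def)
  let ?G = "\<Inter>{X. congruence \<Sigma> B X \<and> \<Theta> \<subseteq> X}"
  have "congruence \<Sigma> B (carrier B \<times> carrier B)" "\<Theta> \<subseteq> carrier B \<times> carrier B"
    using congruence_full[OF B] congruenceD_subset[OF \<Theta>] sub by auto
  then have G: "congruence \<Sigma> B ?G"
    by (intro congruence_Inter) auto
  have "(a, b) \<in> \<Theta>" if ab: "(a, b) \<in> ?G" "a \<in> carrier A" "b \<in> carrier A" for a b
  proof (rule ccontr)
    assume "(a, b) \<notin> \<Theta>"
    then obtain M where M: "meet_irreducible (Con \<Sigma> A) M" "\<Theta> \<subseteq> M" "(a, b) \<notin> M"
      using meet_irreducible_separation[OF A \<Theta>] by blast
    obtain \<Phi> where "congruence \<Sigma> B \<Phi>" "\<Phi> \<inter> (carrier A \<times> carrier A) = M"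
      using ext[OF AB M(1)] by blast
    then show False
      using ab M by blast
  qed
  then have "?G \<inter> (carrier A \<times> carrier A) = \<Theta>"
    using congruenceD_subset[OF \<Theta>] by blast
  then show "\<exists>\<Phi>\<in>carrier (Con \<Sigma> B). \<Phi> \<inter> (carrier A \<times> carrier A) = \<Theta>"
    using G by (auto simp: Con_def)
qed

text \<open>
  Here distributivity enters: for a maximal \<open>\<Phi>\<close> with restriction below \<open>\<Theta>\<close> and \<open>\<Phi> = X \<inter> Y\<close>, the
  restrictions of \<open>X\<close> and \<open>Y\<close> intersect below the meet-prime \<open>\<Theta>\<close>, so one of them lies below \<open>\<Theta>\<close>,
  and maximality applies to \<open>X\<close> or \<open>Y\<close>.
\<close>
lemma ex_meet_irreducible_restricting_below:
  assumes AB: "subalg \<Sigma> A B" and dist: "distributive (Con \<Sigma> A)"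
    and irr: "meet_irreducible (Con \<Sigma> A) \<Theta>"
    and \<Phi>0: "congruence \<Sigma> B \<Phi>0" "\<Phi>0 \<inter> (carrier A \<times> carrier A) \<subseteq> \<Theta>"
  shows "\<exists>\<Phi>. meet_irreducible (Con \<Sigma> B) \<Phi> \<and> \<Phi> \<inter> (carrier A \<times> carrier A) \<subseteq> \<Theta>"
proof -
  have A: "is_alg \<Sigma> A" and B: "is_alg \<Sigma> B"
    using AB by (auto simp: subalg_def)
  let ?AA = "carrier A \<times> carrier A"
  obtain \<Phi> where \<Phi>: "congruence \<Sigma> B \<Phi>" "\<Phi> \<inter> (?AA - \<Theta>) = {}"
    and max: "\<And>X. congruence \<Sigma> B X \<Longrightarrow> \<Phi> \<subseteq> X \<Longrightarrow> X \<inter> (?AA - \<Theta>) = {} \<Longrightarrow> X = \<Phi>"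
    using ex_maximal_congruence_avoiding[OF \<Phi>0(1), of "?AA - \<Theta>"] \<Phi>0(2) by blast
  have "\<Phi> = X \<or> \<Phi> = Y"
    if X: "congruence \<Sigma> B X" and Y: "congruence \<Sigma> B Y" and eq: "\<Phi> = X \<inter> Y" for X Y
  proof -
    have "(X \<inter> ?AA) \<inter> (Y \<inter> ?AA) \<subseteq> \<Theta>"
      using \<Phi>(2) eq by blast
    then have "X \<inter> ?AA \<subseteq> \<Theta> \<or> Y \<inter> ?AA \<subseteq> \<Theta>"
      by (rule meet_irreducible_imp_prime[OF A dist irr
            congruence_restrict[OF AB X] congruence_restrict[OF AB Y]])
    then show ?thesis
      using max[OF X] max[OF Y] eq by blast
  qed
  then have "meet_irreducible (Con \<Sigma> B) \<Phi>"
    using \<Phi>(1) by (simp add: meet_irreducible_Con_iff[OF B])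
  then show ?thesis
    using \<Phi>(2) by blast
qed

lemma variety_is_alg: "variety \<Sigma> V \<Longrightarrow> A \<in> V \<Longrightarrow> is_alg \<Sigma> A"
  unfolding variety_def by (elim conjE) (erule bspec)

lemma variety_hom_image:
  assumes "variety \<Sigma> V" "A \<in> V" "is_alg \<Sigma> B" "alg_hom \<Sigma> A B h" "h ` carrier A = carrier B"
  shows "B \<in> V"
  using assms(1)[unfolded variety_def, THEN conjunct2, THEN conjunct1] assms(2-5) by metis

lemma variety_subalg:
  assumes "variety \<Sigma> V" "B \<in> V" "subalg \<Sigma> A B"
  shows "A \<in> V"
  using assms(1)[unfolded variety_def, THEN conjunct2, THEN conjunct2, THEN conjunct1] assms(2,3) by metis

theorem corollary2p4:
  fixes \<Sigma> :: "'f signature" and V :: "('f, 'a) alg set"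
  assumes "variety \<Sigma> V"
    and "congruence_distributive \<Sigma> V"
  shows "class_cep \<Sigma> V \<longleftrightarrow> class_cep \<Sigma> (FSI \<Sigma> V)"
proof
  show "class_cep \<Sigma> V \<Longrightarrow> class_cep \<Sigma> (FSI \<Sigma> V)"
    by (simp add: class_cep_def FSI_def)
next
  assume cep: "class_cep \<Sigma> (FSI \<Sigma> V)"
  have "alg_cep \<Sigma> B" if BV: "B \<in> V" for B
  proof (rule alg_cep_if_meet_irreducibles_extend)
    show B: "is_alg \<Sigma> B"
      using variety_is_alg[OF assms(1) BV] .
    fix A \<Theta>
    assume AB: "subalg \<Sigma> A B" and irr: "meet_irreducible (Con \<Sigma> A) \<Theta>"
    have A: "is_alg \<Sigma> A"
      using AB by (simp add: subalg_def)
    have "A \<in> V"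
      by (rule variety_subalg[OF assms(1) BV AB])
    then have dist: "distributive (Con \<Sigma> A)"
      using assms(2) by (simp add: congruence_distributive_def)
    have \<Theta>: "congruence \<Sigma> A \<Theta>"
      using irr by (simp add: meet_irreducible_Con_iff[OF A])
    \<comment> \<open>The least congruence is a starting point for the search for a maximal one.\<close>
    have "Id_on (carrier B) \<inter> (carrier A \<times> carrier A) \<subseteq> \<Theta>"
      using congruenceD_refl[OF \<Theta>] by auto
    then obtain \<Phi> where irr\<Phi>: "meet_irreducible (Con \<Sigma> B) \<Phi>"
      and below: "\<Phi> \<inter> (carrier A \<times> carrier A) \<subseteq> \<Theta>"
      using ex_meet_irreducible_restricting_below[OF AB dist irr congruence_Id_on[OF B]] by blast
    have \<Phi>: "congruence \<Sigma> B \<Phi>"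
      using irr\<Phi> by (simp add: meet_irreducible_Con_iff[OF B])
    let ?Q = "quotient_alg B \<Phi>"
    note Q = is_alg_quotient[OF B \<Phi>] and r = alg_hom_class_rep[OF B \<Phi>]
    have "class_rep \<Phi> ` carrier B = carrier ?Q"
      by (simp add: quotient_alg_def)
    then have "?Q \<in> V"
      by (rule variety_hom_image[OF assms(1) BV Q r])
    then have "?Q \<in> FSI \<Sigma> V"
      using meet_irreducible_quotient[OF B irr\<Phi>] by (simp add: FSI_def)
    then have "alg_cep \<Sigma> ?Q"
      using cep by (simp add: class_cep_def)
    moreover have "(x, y) \<in> \<Theta>"
      if "x \<in> carrier A" "y \<in> carrier A" "class_rep \<Phi> x = class_rep \<Phi> y" for x y
    proof -
      have "x \<in> carrier B" "y \<in> carrier B"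
        using AB that by (auto simp: subalg_def)
      then show ?thesis
        using class_rep_eq_iff[OF congruenceD_equiv[OF \<Phi>]] below that by blast
    qed
    ultimately show "\<exists>\<Psi>. congruence \<Sigma> B \<Psi> \<and> \<Psi> \<inter> (carrier A \<times> carrier A) = \<Theta>"
      using r by (intro extend_along_hom[OF AB \<Theta> Q])
  qed
  then show "class_cep \<Sigma> V"
    by (simp add: class_cep_def)
qed

end
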